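(* Suppose that $D\subseteq(0,1)$ is a closed set and $(t_n)$ is a sequence of non-negative integers. If $Q=(q_n)$ is a basic sequence that is infinite in limit, $\lim_{n\to\infty}\frac{\log q_{n+j}}{\log (q_1\cdots q_n)}=0$ for all $j\in\mathbb{N}$, $\sum_{n=1}^\infty\frac{t_n}{q_n}<\infty$, and $q_n-t_n\ge3$ for all $n$, then $\dim_H\left(\mathbb{E}_{D,(t_n)}(Q)\right)=1$.
   Context: A basic sequence is a sequence $Q=(q_n)_{n\ge1}$ of integers $q_n\ge 2$; it is infinite in limit if $q_n\to\infty$. The $Q$-Cantor series expansion of $x\in\mathbb{R}$, abbreviated $x=E_0.E_1E_2\cdots$ w.r.t. $Q$, is the unique expansion $x=E_0+\sum_{n\ge1}\frac{E_n}{q_1\cdots q_n}$ with $E_0=\lfloor x\rfloor$, $E_n\in\{0,\ldots,q_n-1\}$ for $n\ge 1$, and $E_n\ne q_n-1$ infinitely often. For a sequence $X$ of real numbers, $\mathbb{A}(X)$ is the set of accumulation points of $X$. For $D\subseteq[0,1]$ and a sequence $(t_n)$ of non-negative integers, $$\mathbb{E}_{D,(t_n)}(Q)=\{x=0.E_1E_2\cdots\text{ w.r.t. }Q:\ \mathbb{A}((E_n/q_n))=D\text{ and }E_n<q_n-t_n\text{ for all }n\}.$$ $\dim_H$ denotes Hausdorff dimension.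
   Formalization: D is additionally assumed non-empty: for D = ∅ the set is empty, since the bounded sequence (E_n/q_n) always has an accumulation point, so its dimension is not 1 and the claim fails. *)

theory Defs
  imports "HOL-Analysis.Analysis"
begin

(* Sequences indexed by n >= 1 are functions on nat whose value at 0 is irrelevant. *)

definition basic_sequence :: "(nat \<Rightarrow> int) \<Rightarrow> bool" where
  "basic_sequence q \<longleftrightarrow> (\<forall>n\<ge>1. q n \<ge> 2)"

definition infinite_in_limit :: "(nat \<Rightarrow> int) \<Rightarrow> bool" where
  "infinite_in_limit q \<longleftrightarrow> filterlim q at_top sequentially"

(* E is the digit sequence of x = E 0 . E 1 E 2 ... with respect to q; here E 0 is the integer part. *)
definition cantor_expansion :: "(nat \<Rightarrow> int) \<Rightarrow> real \<Rightarrow> (nat \<Rightarrow> int) \<Rightarrow> bool" where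
  "cantor_expansion q x E \<longleftrightarrow>
     E 0 = \<lfloor>x\<rfloor> \<and>
     (\<forall>n\<ge>1. E n \<in> {0..q n - 1}) \<and>
     infinite {n. n \<ge> 1 \<and> E n \<noteq> q n - 1} \<and>
     summable (\<lambda>n. of_int (E (Suc n)) / of_int (\<Prod>i=1..Suc n. q i) :: real) \<and>
     x = of_int (E 0) + (\<Sum>n. of_int (E (Suc n)) / of_int (\<Prod>i=1..Suc n. q i))"

(* Accumulation points of a sequence, as opposed to limit points of its range:
   a value attained infinitely often is an accumulation point. *)
definition accumulation_points :: "(nat \<Rightarrow> 'a::topological_space) \<Rightarrow> 'a set" where
  "accumulation_points X = {x. \<forall>U. open U \<and> x \<in> U \<longrightarrow> infinite {n. X n \<in> U}}"

definition EE :: "real set \<Rightarrow> (nat \<Rightarrow> nat) \<Rightarrow> (nat \<Rightarrow> int) \<Rightarrow> real set" where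
  "EE D t q = {x. \<exists>E. cantor_expansion q x E \<and> E 0 = 0 \<and>
     accumulation_points (\<lambda>n. of_int (E (Suc n)) / of_int (q (Suc n))) = D \<and>
     (\<forall>n\<ge>1. E n < q n - int (t n))}"

(* The power diam(U)^s, with the conventions diam({})^s = 0 and 0^0 = 1
   for nonempty U. *)
definition diam_power :: "real \<Rightarrow> 'a::metric_space set \<Rightarrow> ennreal" where
  "diam_power s U =
     (if U = {} then 0 else if s = 0 then 1 else ennreal (diameter U powr s))"

(* Boundedness of the covering sets is required explicitly because diameter
   is only meaningful for bounded sets. Empty sets may occur in a cover, so finite
   covers are included. *)
definition hausdorff_pre_measure :: "real \<Rightarrow> real \<Rightarrow> 'a::metric_space set \<Rightarrow> ennreal" where
  "hausdorff_pre_measure s \<delta> A =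
     (INF U \<in> {U :: nat \<Rightarrow> 'a set. A \<subseteq> (\<Union>i. U i) \<and> (\<forall>i. bounded (U i) \<and> diameter (U i) \<le> \<delta>)}.
        (\<Sum>i. diam_power s (U i)))"

definition hausdorff_measure :: "real \<Rightarrow> 'a::metric_space set \<Rightarrow> ennreal" where
  "hausdorff_measure s A = (SUP \<delta> \<in> {0<..}. hausdorff_pre_measure s \<delta> A)"

definition hausdorff_dim :: "'a::metric_space set \<Rightarrow> ennreal" where
  "hausdorff_dim A = (INF s \<in> {s. 0 \<le> s \<and> hausdorff_measure s A = 0}. ennreal s)"

end

theory Submission
  imports Defs
begin

text \<open>
  The dimension is at most 1 because the set lies in the unit interval. For the lower bound, fix
  \<open>s < \<sigma> < 1\<close> and a sequence \<open>c\<^sub>n\<close> in \<open>D\<close> whose accumulation points are exactly \<open>D\<close>. For large \<open>n\<close>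
  let the digit \<open>E\<^sub>n\<close> range freely over a block of about \<open>q\<^sub>n powr \<sigma>\<close> integers starting at
  \<open>\<lfloor>c\<^sub>n q\<^sub>n\<rfloor>\<close>. As \<open>q\<^sub>n powr \<sigma> = o(q\<^sub>n)\<close>, the ratios \<open>E\<^sub>n / q\<^sub>n\<close> have the accumulation points \<open>D\<close>.
  Reading the position within the block as a digit to the base \<open>m\<^sub>n\<close>, the block length, maps
  the points so obtained onto \<open>[0,1)\<close>. If two of them first differ in digit \<open>n\<close>, their images
  are within \<open>1 / (m\<^sub>1 \<dots> m\<^sub>n\<^sub>-\<^sub>1)\<close>, while the points are at least \<open>1 / (2 q\<^sub>1 \<dots> q\<^sub>n)\<close> apart,
  because the blocks take up at most half of the alphabet. By the growth condition on \<open>q\<close> the map is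
  thus Hoelder continuous of exponent \<open>s\<close>, so any cover of the set yields a cover of
  \<open>[0,1)\<close>, and the \<open>s\<close>-dimensional measure is positive.
\<close>

section \<open>Hausdorff measure and dimension\<close>

text \<open>The estimate \<open>holder\<close> says that the inverse of \<open>g\<close> on its
  image is Hoelder continuous. A cover of \<open>A\<close> therefore pulls back to a cover of the
  unit interval by intervals of total length at most \<open>2 * K\<close> times the
  \<open>s\<close>-sum, so that sum is at least \<open>1 / (2 * K)\<close>.\<close>

lemma hausdorff_measure_nonzero:
  fixes A :: "'a::metric_space set" and g :: "real \<Rightarrow> 'a"
  assumes s: "0 < s" and K: "0 < K" and g: "g ` {0..<1} \<subseteq> A"
    and holder: "\<And>y z. y \<in> {0..<1} \<Longrightarrow> z \<in> {0..<1} \<Longrightarrow> \<bar>y - z\<bar> \<le> K * dist (g y) (g z) powr s"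
  shows "hausdorff_measure s A \<noteq> 0"
proof
  assume "hausdorff_measure s A = 0"
  then have "hausdorff_pre_measure s 1 A = 0"
    unfolding hausdorff_measure_def
    by (metis SUP_upper greaterThan_iff le_zero_eq zero_less_one)
  moreover have "0 < ennreal (1 / (2 * K))" using K by simp
  ultimately have "hausdorff_pre_measure s 1 A < ennreal (1 / (2 * K))" by simp
  then obtain U where cover: "A \<subseteq> (\<Union>i::nat. U i)" and bdd: "\<And>i. bounded (U i)"
    and small: "(\<Sum>i. diam_power s (U i)) < ennreal (1 / (2 * K))"
    unfolding hausdorff_pre_measure_def INF_less_iff by blast
  define r where "r i = K * diameter (U i) powr s" for i
  \<comment> \<open>By \<open>holder\<close>, all points that \<open>g\<close> sends into
    \<open>U i\<close> lie within \<open>r i\<close> of one of them, \<open>v i\<close>. If there is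
    none, \<open>v i\<close> is arbitrary and \<open>V i\<close> only adds an interval obeying the
    same length bound.\<close>
  define v where "v i = (SOME y. y \<in> {0..<1} \<and> g y \<in> U i)" for i
  define V where "V i = (if U i = {} then {} else {v i - r i..v i + r i})" for i
  have "{0..<1} \<subseteq> (\<Union>i. V i)"
  proof
    fix y :: real assume y: "y \<in> {0..<1}"
    then obtain i where i: "g y \<in> U i" using g cover by blast
    have v: "v i \<in> {0..<1} \<and> g (v i) \<in> U i"
      unfolding v_def by (rule someI[of _ y]) (use y i in blast)
    have "dist (g y) (g (v i)) \<le> diameter (U i)"
      using diameter_bounded_bound[OF bdd i] v by blast
    then have "K * dist (g y) (g (v i)) powr s \<le> r i"
      unfolding r_def using s K by (intro mult_left_mono powr_mono2) auto
    then have "\<bar>y - v i\<bar> \<le> r i" using holder[OF y, of "v i"] v by linarith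
    then have "y \<in> V i" using i by (auto simp: V_def)
    then show "y \<in> (\<Union>i. V i)" by blast
  qed
  then have "emeasure lborel {0..<1::real} \<le> emeasure lborel (\<Union>i. V i)"
    by (intro emeasure_mono) (auto simp: V_def)
  also have "\<dots> \<le> (\<Sum>i. emeasure lborel (V i))"
    by (intro emeasure_subadditive_countably) (auto simp: V_def)
  also have "\<dots> \<le> (\<Sum>i. ennreal (2 * K) * diam_power s (U i))"
  proof (intro suminf_le)
    fix i
    have "0 \<le> r i" using K by (simp add: r_def)
    then have "emeasure lborel {v i - r i..v i + r i} = ennreal (2 * r i)" by simp
    also have "\<dots> = ennreal (2 * K) * ennreal (diameter (U i) powr s)"
      using K by (simp add: r_def ennreal_mult' flip: mult.assoc)
    finally show "emeasure lborel (V i) \<le> ennreal (2 * K) * diam_power s (U i)"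
      using s by (simp add: V_def diam_power_def)
  qed auto
  also have "\<dots> = ennreal (2 * K) * (\<Sum>i. diam_power s (U i))" by simp
  also have "\<dots> < ennreal (2 * K) * ennreal (1 / (2 * K))"
    using small K by (intro ennreal_mult_strict_left_mono) auto
  also have "\<dots> = 1" using K by (simp add: ennreal_mult'[symmetric])
  finally show False by simp
qed

text \<open>At exponent 0 each nonempty covering set contributes 1. This settles the one exponent
  below 1 that the Hoelder argument, which needs \<open>0 < s\<close>, leaves open.\<close>

lemma hausdorff_measure_0_nonzero:
  assumes "A \<noteq> {}"
  shows "hausdorff_measure 0 A \<noteq> 0"
proof
  obtain x where x: "x \<in> A" using assms by blast
  have "1 \<le> hausdorff_pre_measure 0 1 A"
    unfolding hausdorff_pre_measure_def
  proof (rule INF_greatest)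
    fix U :: "nat \<Rightarrow> _"
    assume "U \<in> {U. A \<subseteq> (\<Union>i. U i) \<and> (\<forall>i. bounded (U i) \<and> diameter (U i) \<le> 1)}"
    then obtain i where "x \<in> U i" using x by blast
    then have "1 \<le> (\<Sum>j\<in>{i}. diam_power 0 (U j))" by (auto simp: diam_power_def)
    also have "\<dots> \<le> (\<Sum>j. diam_power 0 (U j))" by (intro sum_le_suminf) auto
    finally show "1 \<le> (\<Sum>j. diam_power 0 (U j))" .
  qed
  also have "\<dots> \<le> hausdorff_measure 0 A"
    unfolding hausdorff_measure_def by (rule SUP_upper) simp
  finally have "1 \<le> hausdorff_measure 0 A" .
  moreover assume "hausdorff_measure 0 A = 0"
  ultimately show False by simp
qed

text \<open>Cutting the unit interval into \<open>k\<close> pieces of length \<open>1 / k\<close>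
  costs \<open>k powr (1 - s)\<close>, which tends to 0.\<close>

lemma hausdorff_measure_unit_interval:
  fixes A :: "real set"
  assumes A: "A \<subseteq> {0..<1}" and s: "1 < s"
  shows "hausdorff_measure s A = 0"
proof -
  have "hausdorff_pre_measure s \<delta> A \<le> 0" if \<delta>: "0 < \<delta>" for \<delta>
  proof (rule tendsto_lowerbound)
    have "(\<lambda>k. real k powr (1 - s)) \<longlonglongrightarrow> 0"
      using s by (intro tendsto_neg_powr filterlim_real_sequentially) auto
    then show "(\<lambda>k. ennreal (real k powr (1 - s))) \<longlonglongrightarrow> 0"
      by (metis ennreal_0 tendsto_ennrealI)
    have "(\<lambda>k. 1 / real k) \<longlonglongrightarrow> 0" by (rule lim_1_over_n)
    then have "\<forall>\<^sub>F k in sequentially. 1 / real k < \<delta>" using \<delta> by (rule order_tendstoD)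
    then show "\<forall>\<^sub>F k in sequentially. hausdorff_pre_measure s \<delta> A \<le> ennreal (real k powr (1 - s))"
      using eventually_gt_at_top[of 0]
    proof eventually_elim
      case (elim k)
      define U where "U i = (if i < k then {real i / k..real (Suc i) / k} else {})" for i
      have "A \<subseteq> (\<Union>i. U i)"
      proof
        fix x assume "x \<in> A"
        then have x: "0 \<le> x" "x < 1" using A by auto
        define i where "i = nat \<lfloor>x * k\<rfloor>"
        have i: "real i \<le> x * k" "x * k \<le> real (Suc i)" unfolding i_def using x elim by (simp_all) linarith
        moreover have "x * k < 1 * real k" using x elim by (intro mult_strict_right_mono) auto
        ultimately have "i < k" by linarith
        then have "x \<in> U i" using i elim by (auto simp: U_def field_simps)
        then show "x \<in> (\<Union>i. U i)" by blast
      qed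
      moreover have diam: "diameter (U i) = 1 / k" if "i < k" for i
      proof -
        have "real i / k \<le> real (Suc i) / k" using elim by (simp add: divide_right_mono)
        then show ?thesis using that elim
          by (simp add: U_def diameter_closed_interval diff_divide_distrib[symmetric])
      qed
      moreover have "diameter (U i) \<le> \<delta>" for i
        using diam[of i] elim \<delta> by (cases "i < k") (auto simp: U_def)
      ultimately have "hausdorff_pre_measure s \<delta> A \<le> (\<Sum>i. diam_power s (U i))"
        unfolding hausdorff_pre_measure_def by (intro INF_lower) (auto simp: U_def)
      also have "\<dots> = (\<Sum>i<k. diam_power s (U i))"
        by (intro suminf_finite) (auto simp: U_def diam_power_def)
      also have "\<dots> = (\<Sum>i<k. ennreal ((1 / k) powr s))"
      proof (intro sum.cong refl)
        fix i assume "i \<in> {..<k}"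
        then have "diameter (U i) = 1 / k" "U i \<noteq> {}" using diam elim
          by (auto simp: U_def divide_right_mono)
        then show "diam_power s (U i) = ennreal ((1 / k) powr s)"
          using s by (simp add: diam_power_def)
      qed
      also have "\<dots> = ennreal (real k * (1 / k) powr s)"
        by (simp add: ennreal_mult' ennreal_of_nat_eq_real_of_nat)
      also have "real k * (1 / k) powr s = real k powr (1 - s)"
        using elim by (simp add: powr_diff powr_divide)
      finally show ?case .
    qed
  qed simp
  then show ?thesis unfolding hausdorff_measure_def by (simp add: SUP_eq_iff bot_ennreal)
qed

lemma hausdorff_dim_eq_1I:
  fixes A :: "real set"
  assumes A: "A \<subseteq> {0..<1}"
    and pos: "\<And>s. 0 < s \<Longrightarrow> s < 1 \<Longrightarrow> hausdorff_measure s A \<noteq> 0"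
    and ne: "A \<noteq> {}"
  shows "hausdorff_dim A = 1"
proof (rule antisym)
  show "1 \<le> hausdorff_dim A"
    unfolding hausdorff_dim_def
  proof (rule INF_greatest)
    fix s assume "s \<in> {s. 0 \<le> s \<and> hausdorff_measure s A = 0}"
    then have "1 \<le> s" using pos[of s] hausdorff_measure_0_nonzero[OF ne]
      by (cases "s = 0") force+
    then show "1 \<le> ennreal s" by simp
  qed
  show "hausdorff_dim A \<le> 1"
  \<comment> \<open>Vanishing measure is known only for exponents strictly above 1, so 1 is reached
    as a limit of such exponents.\<close>
  proof (rule tendsto_lowerbound)
    have "(\<lambda>n. 1 + 1 / real n) \<longlonglongrightarrow> 1 + 0" by (intro tendsto_intros lim_1_over_n)
    then show "(\<lambda>n. ennreal (1 + 1 / real n)) \<longlonglongrightarrow> 1"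
      by (metis add.right_neutral ennreal_1 tendsto_ennrealI)
    show "\<forall>\<^sub>F n in sequentially. hausdorff_dim A \<le> ennreal (1 + 1 / real n)"
      using eventually_gt_at_top[of 0]
    proof eventually_elim
      case (elim n)
      then show ?case unfolding hausdorff_dim_def
        by (intro INF_lower) (auto intro!: hausdorff_measure_unit_interval[OF A])
    qed
  qed simp
qed

section \<open>Mixed radix digits\<close>

text \<open>The expansion is to the bases \<open>m 0, m 1, ...\<close>, with digits counted from 0.
  As a difference of floors, a digit is exactly what passes from one truncation to the next. A base
  equal to 1 is allowed and gives the digit 0.\<close>

definition digit :: "(nat \<Rightarrow> nat) \<Rightarrow> real \<Rightarrow> nat \<Rightarrow> int" where
  "digit m y n = \<lfloor>y * real (\<Prod>i<Suc n. m i)\<rfloor> - int (m n) * \<lfloor>y * real (\<Prod>i<n. m i)\<rfloor>"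

lemma digit_bounds:
  assumes "1 \<le> m n"
  shows "0 \<le> digit m y n" "digit m y n < int (m n)"
proof -
  define z where "z = y * real (\<Prod>i<n. m i)"
  have d: "digit m y n = \<lfloor>z * real (m n)\<rfloor> - int (m n) * \<lfloor>z\<rfloor>"
    by (simp add: digit_def z_def algebra_simps)
  have "real_of_int \<lfloor>z\<rfloor> * real (m n) \<le> z * real (m n)" by (intro mult_right_mono) auto
  then have "int (m n) * \<lfloor>z\<rfloor> \<le> \<lfloor>z * real (m n)\<rfloor>"
    by (simp add: le_floor_iff mult.commute)
  then show "0 \<le> digit m y n" using d by simp
  have "z * real (m n) < (real_of_int \<lfloor>z\<rfloor> + 1) * real (m n)"
    using assms by (intro mult_strict_right_mono) auto
  also have "\<dots> = real_of_int (int (m n) * \<lfloor>z\<rfloor> + int (m n))" by (simp add: algebra_simps)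
  finally have "\<lfloor>z * real (m n)\<rfloor> < int (m n) * \<lfloor>z\<rfloor> + int (m n)" by (simp add: floor_less_iff)
  then show "digit m y n < int (m n)" using d by simp
qed

text \<open>Equal integer parts and equal first \<open>n\<close> digits put \<open>y\<close> and
  \<open>z\<close> into the same cell of the \<open>n\<close>-th subdivision.\<close>

lemma digits_eq_imp_close:
  assumes m: "\<And>i. 1 \<le> m i" and yz: "y \<in> {0..<1}" "z \<in> {0..<1}"
    and eq: "\<And>i. i < n \<Longrightarrow> digit m y i = digit m z i"
  shows "\<bar>y - z\<bar> \<le> 1 / real (\<Prod>i<n. m i)"
proof -
  have "k \<le> n \<Longrightarrow> \<lfloor>y * real (\<Prod>i<k. m i)\<rfloor> = \<lfloor>z * real (\<Prod>i<k. m i)\<rfloor>" for k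
  proof (induction k)
    case 0
    have "\<lfloor>y\<rfloor> = 0" "\<lfloor>z\<rfloor> = 0" using yz by (auto simp: floor_eq_iff)
    then show ?case by simp
  next
    case (Suc k)
    then show ?case using eq[of k] by (simp add: digit_def)
  qed
  then have "\<lfloor>y * real (\<Prod>i<n. m i)\<rfloor> = \<lfloor>z * real (\<Prod>i<n. m i)\<rfloor>" by simp
  then have "\<bar>y * real (\<Prod>i<n. m i) - z * real (\<Prod>i<n. m i)\<bar> < 1" by linarith
  moreover have pos: "0 < real (\<Prod>i<n. m i)" using m by (simp add: prod_pos Suc_le_eq)
  ultimately have "\<bar>y - z\<bar> * real (\<Prod>i<n. m i) < 1"
    by (simp only: left_diff_distrib[symmetric] abs_mult abs_of_pos)
  then show ?thesis using pos by (simp add: pos_le_divide_eq del: of_nat_prod)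
qed

section \<open>Cantor series\<close>

lemma power_le_prod:
  fixes b :: "nat \<Rightarrow> real"
  assumes "\<And>i. 2 \<le> b i"
  shows "2 ^ n \<le> (\<Prod>i<n. b i)"
proof -
  have "(\<Prod>i<n. 2) \<le> (\<Prod>i<n. b i)" by (intro prod_mono) (use assms in auto)
  then show ?thesis by simp
qed

lemma prod_pos_of_ge_2:
  fixes b :: "nat \<Rightarrow> real"
  assumes "\<And>i. 2 \<le> b i"
  shows "0 < (\<Prod>i<n. b i)"
  using power_le_prod[of b n, OF assms] zero_less_power[of "2::real" n] by linarith

lemma prod_at_top:
  fixes b :: "nat \<Rightarrow> real"
  assumes "\<And>i. 2 \<le> b i"
  shows "filterlim (\<lambda>n. \<Prod>i<n. b i) at_top sequentially"
proof (rule filterlim_at_top_mono[OF _ always_eventually[OF allI]])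
  show "real n \<le> (\<Prod>i<n. b i)" for n
    using power_le_prod[of b n, OF assms] of_nat_less_two_power[of n, where 'a=real] by linarith
qed (rule filterlim_real_sequentially)

text \<open>The series with maximal digits telescopes: with \<open>P n\<close> the product of the
  first \<open>n\<close> bases, its terms are \<open>1 / P i - 1 / P (Suc i)\<close>.\<close>

lemma cantor_tail_sums:
  fixes b :: "nat \<Rightarrow> real"
  assumes b: "\<And>i. 2 \<le> b i"
  shows "(\<lambda>i. (b (i + k) - 1) / (\<Prod>j<Suc (i + k). b j)) sums (1 / (\<Prod>j<k. b j))"
proof -
  define P where "P n = (\<Prod>j<n. b j)" for n
  have P: "P (Suc n) = P n * b n" "0 < P n" for n
    using prod_pos_of_ge_2[of b, OF b] by (auto simp: P_def)
  have "(\<lambda>i. 1 / P (i + k)) \<longlonglongrightarrow> 0"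
    by (rule LIMSEQ_ignore_initial_segment)
      (use prod_at_top[of b, OF b] in \<open>auto simp: P_def divide_inverse intro: tendsto_inverse_0_at_top\<close>)
  then have "(\<lambda>i. 1 / P (i + k) - 1 / P (Suc i + k)) sums (1 / P (0 + k) - 0)"
    by (rule telescope_sums')
  moreover have "1 / P (i + k) - 1 / P (Suc i + k) = (b (i + k) - 1) / P (Suc (i + k))" for i
    using P(2)[of "i + k"] b[of "i + k"] by (simp add: P(1) field_simps)
  ultimately show ?thesis by (simp add: P_def)
qed

lemma cantor_summable:
  fixes b :: "nat \<Rightarrow> real" and E :: "nat \<Rightarrow> int"
  assumes b: "\<And>i. 2 \<le> b i" and E: "\<And>i. 0 \<le> E i" "\<And>i. real_of_int (E i) \<le> b i - 1"
  shows "summable (\<lambda>i. E i / (\<Prod>j<Suc i. b j))"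
proof (rule summable_comparison_test')
  show "summable (\<lambda>i. (b i - 1) / (\<Prod>j<Suc i. b j))"
    using cantor_tail_sums[of b 0, OF b] by (auto simp: sums_iff)
  fix i :: nat
  have "0 < (\<Prod>j<Suc i. b j)" by (rule prod_pos_of_ge_2[of b, OF b])
  then show "norm (E i / (\<Prod>j<Suc i. b j)) \<le> (b i - 1) / (\<Prod>j<Suc i. b j)"
    using E[of i] by (simp add: divide_right_mono del: prod.lessThan_Suc)
qed

text \<open>Maximal digits throughout give the sum 1, and a single smaller digit, at
  \<open>k\<close>, makes the sum strictly smaller. This gives the integer part 0 later on.\<close>

lemma cantor_series_less_1:
  fixes b :: "nat \<Rightarrow> real" and E :: "nat \<Rightarrow> int"
  assumes b: "\<And>i. 2 \<le> b i" and E: "\<And>i. 0 \<le> E i" "\<And>i. real_of_int (E i) \<le> b i - 1"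
    and j: "real_of_int (E k) < b k - 1"
  shows "(\<Sum>i. E i / (\<Prod>j<Suc i. b j)) < 1"
proof -
  define P where "P n = (\<Prod>j<n. b j)" for n
  have P: "0 < P n" for n
    using prod_pos_of_ge_2[of b, OF b] by (auto simp: P_def)
  have s: "(\<lambda>i. (b i - 1) / P (Suc i)) sums 1"
    using cantor_tail_sums[of b 0, OF b] by (simp add: P_def)
  have e: "summable (\<lambda>i. E i / P (Suc i))"
    using cantor_summable[of b E, OF b E] by (simp add: P_def)
  have "0 < (\<Sum>i. (b i - 1) / P (Suc i) - E i / P (Suc i))"
  proof (rule suminf_pos2)
    show "summable (\<lambda>i. (b i - 1) / P (Suc i) - E i / P (Suc i))"
      using s e by (intro summable_diff) (auto simp: sums_iff)
    show "0 \<le> (b i - 1) / P (Suc i) - E i / P (Suc i)" for i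
      using E(2)[of i] P[of "Suc i"] by (simp add: diff_divide_distrib[symmetric])
    show "0 < (b k - 1) / P (Suc k) - E k / P (Suc k)"
      using j P[of "Suc k"] by (simp add: diff_divide_distrib[symmetric])
  qed
  also have "\<dots> = 1 - (\<Sum>i. E i / P (Suc i))"
    using suminf_diff[OF _ e, of "\<lambda>i. (b i - 1) / P (Suc i)"] s by (simp add: sums_iff)
  finally show ?thesis by (simp add: P_def)
qed

text \<open>The first differing digit contributes at least \<open>1 / P (Suc n)\<close>. By
  \<open>close\<close>, the later differences are at most half the maximal digits, so the tail can
  cancel at most half of this. Without the factor 1/2 a carry could bring the two sums arbitrarily
  close.\<close>

lemma cantor_separation:
  fixes b :: "nat \<Rightarrow> real" and E F :: "nat \<Rightarrow> int"
  assumes b: "\<And>i. 2 \<le> b i"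
    and E: "\<And>i. 0 \<le> E i" "\<And>i. real_of_int (E i) \<le> b i - 1"
    and F: "\<And>i. 0 \<le> F i" "\<And>i. real_of_int (F i) \<le> b i - 1"
    and close: "\<And>i. real_of_int \<bar>E i - F i\<bar> \<le> (b i - 1) / 2"
    and eq: "\<And>i. i < n \<Longrightarrow> E i = F i" and neq: "E n \<noteq> F n"
  shows "1 / (2 * (\<Prod>j<Suc n. b j))
    \<le> \<bar>(\<Sum>i. E i / (\<Prod>j<Suc i. b j)) - (\<Sum>i. F i / (\<Prod>j<Suc i. b j))\<bar>"
proof -
  define P where "P n = (\<Prod>j<n. b j)" for n
  define d where "d i = (E i - F i) / P (Suc i)" for i
  have P: "0 < P n" for n
    using prod_pos_of_ge_2[of b, OF b] by (auto simp: P_def)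
  have e: "summable (\<lambda>i. E i / P (Suc i))" "summable (\<lambda>i. F i / P (Suc i))"
    using cantor_summable[of b E, OF b E] cantor_summable[of b F, OF b F] by (simp_all add: P_def)
  have d: "d = (\<lambda>i. E i / P (Suc i) - F i / P (Suc i))"
    by (simp add: d_def fun_eq_iff diff_divide_distrib)
  have sd: "summable d" unfolding d by (intro summable_diff e)
  have "(\<Sum>i. E i / P (Suc i)) - (\<Sum>i. F i / P (Suc i)) = suminf d"
    unfolding d by (intro suminf_diff e)
  also have "\<dots> = (\<Sum>i. d (i + Suc n)) + (\<Sum>i<Suc n. d i)"
    by (rule suminf_split_initial_segment[OF sd])
  also have "(\<Sum>i<Suc n. d i) = d n" using eq by (simp add: d_def)
  finally have *: "(\<Sum>i. E i / P (Suc i)) - (\<Sum>i. F i / P (Suc i)) = (\<Sum>i. d (i + Suc n)) + d n" .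
  have t: "(\<lambda>i. (b (i + Suc n) - 1) / P (Suc (i + Suc n)) / 2) sums (1 / P (Suc n) / 2)"
    using sums_divide[OF cantor_tail_sums[of b "Suc n", OF b], of 2] by (simp add: P_def)
  have "norm (\<Sum>i. d (i + Suc n)) \<le> (\<Sum>i. (b (i + Suc n) - 1) / P (Suc (i + Suc n)) / 2)"
  proof (rule norm_suminf_le)
    show "summable (\<lambda>i. (b (i + Suc n) - 1) / P (Suc (i + Suc n)) / 2)" using t by (auto simp: sums_iff)
    fix i
    have "norm (d (i + Suc n)) = \<bar>E (i + Suc n) - F (i + Suc n)\<bar> / P (Suc (i + Suc n))"
      using P[of "Suc (i + Suc n)"] by (simp add: d_def abs_divide abs_of_pos del: add_Suc_right)
    also have "\<dots> \<le> (b (i + Suc n) - 1) / 2 / P (Suc (i + Suc n))"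
      using close[of "i + Suc n"] P[of "Suc (i + Suc n)"] by (intro divide_right_mono) auto
    finally show "norm (d (i + Suc n)) \<le> (b (i + Suc n) - 1) / P (Suc (i + Suc n)) / 2"
      by (simp add: mult.commute)
  qed
  then have small: "\<bar>\<Sum>i. d (i + Suc n)\<bar> \<le> 1 / P (Suc n) / 2" using t by (simp add: sums_iff)
  have "1 \<le> \<bar>real_of_int (E n - F n)\<bar>" using neq by linarith
  then have large: "1 / P (Suc n) \<le> \<bar>d n\<bar>"
    using P[of "Suc n"] by (simp add: d_def divide_right_mono)
  have "c / 2 \<le> \<bar>v + u\<bar>" if "\<bar>v\<bar> \<le> c / 2" "c \<le> \<bar>u\<bar>" for c u v :: real
    using that by linarith
  from this[OF small large] show ?thesis
    unfolding * [symmetric] P_def by (simp only: divide_divide_eq_left mult.commute)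
qed

section \<open>Accumulation points of sequences\<close>

text \<open>Up to finitely many indices, a visit of \<open>X\<close> to the ball of radius
  \<open>e / 2\<close> is a visit of \<open>Y\<close> to the ball of radius \<open>e\<close>. The
  lemma lets the digit ratios be replaced by the prescribed sequence in \<open>D\<close>.\<close>

lemma accumulation_points_cong:
  fixes X Y :: "nat \<Rightarrow> 'a::real_normed_vector"
  assumes "(\<lambda>n. X n - Y n) \<longlonglongrightarrow> 0"
  shows "accumulation_points X = accumulation_points Y"
proof -
  have *: "accumulation_points X \<subseteq> accumulation_points Y"
    if lim: "(\<lambda>n. X n - Y n) \<longlonglongrightarrow> 0" for X Y :: "nat \<Rightarrow> 'a"
  proof
    fix x assume x: "x \<in> accumulation_points X"
    show "x \<in> accumulation_points Y"
      unfolding accumulation_points_def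
    proof (safe)
      fix U assume U: "open U" "x \<in> U" and fin: "finite {n. Y n \<in> U}"
      obtain e where e: "0 < e" "ball x e \<subseteq> U" using U open_contains_ball by blast
      obtain N where N: "\<And>n. N \<le> n \<Longrightarrow> norm (X n - Y n) < e / 2"
        using LIMSEQ_D[OF lim, of "e / 2"] e by auto
      have "{n. X n \<in> ball x (e / 2)} \<subseteq> {n. Y n \<in> U} \<union> {..<N}"
      proof
        fix n assume "n \<in> {n. X n \<in> ball x (e / 2)}"
        then have "dist x (X n) < e / 2" by simp
        moreover have "dist (X n) (Y n) < e / 2" if "N \<le> n" using N[OF that] by (simp add: dist_norm)
        ultimately have "dist x (Y n) < e" if "N \<le> n"
          using that dist_triangle_half_l[of x "X n" e "Y n"] by (simp add: dist_commute)
        then show "n \<in> {n. Y n \<in> U} \<union> {..<N}" using e by (cases "N \<le> n") auto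
      qed
      then have "finite {n. X n \<in> ball x (e / 2)}" using fin by (auto intro: finite_subset)
      moreover have "infinite {n. X n \<in> ball x (e / 2)}"
        using x e(1) unfolding accumulation_points_def mem_Collect_eq
        by (elim allE[of _ "ball x (e / 2)"] impE) simp_all
      ultimately show False by blast
    qed
  qed
  have "(\<lambda>n. Y n - X n) \<longlonglongrightarrow> 0" using tendsto_minus[OF assms] by simp
  then show ?thesis using *[OF assms] * by blast
qed

lemma accumulation_points_exists:
  fixes D :: "'a::{metric_space, second_countable_topology} set"
  assumes "closed D" "D \<noteq> {}"
  obtains c where "range c \<subseteq> D" "accumulation_points c = D"
proof -
  obtain T where T: "countable T" "T \<subseteq> D" "D \<subseteq> closure T" by (rule separable)
  have ne: "T \<noteq> {}" using T assms by auto
  \<comment> \<open>The first component of the pairing runs through a countable dense subset of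
    \<open>D\<close> and takes each index infinitely often, so isolated points of \<open>D\<close>
    are accumulation points too.\<close>
  define c where "c n = from_nat_into T (fst (prod_decode n))" for n
  have cT: "c n \<in> T" for n unfolding c_def by (rule from_nat_into[OF ne])
  have "x \<in> accumulation_points c" if x: "x \<in> D" for x
    unfolding accumulation_points_def
  proof safe
    fix U assume U: "open U" "x \<in> U" and fin: "finite {n. c n \<in> U}"
    obtain y where y: "y \<in> T" "y \<in> U" using T(3) x U
      by (meson closure_iff_nhds_not_empty IntE ex_in_conv subsetD order_refl)
    then obtain k where k: "from_nat_into T k = y"
      using T(1) by (metis from_nat_into_surj)
    have "range (\<lambda>j. prod_encode (k, j)) \<subseteq> {n. c n \<in> U}" using y k by (auto simp: c_def)
    moreover have "infinite (range (\<lambda>j. prod_encode (k, j)))"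
      by (rule range_inj_infinite) (auto simp: inj_on_def)
    ultimately show False using fin finite_subset by blast
  qed
  moreover have "x \<in> D" if "x \<in> accumulation_points c" for x
  proof (rule ccontr)
    assume "x \<notin> D"
    then have "infinite {n. c n \<in> - D}"
      using that assms(1) unfolding accumulation_points_def by (auto simp: open_Compl)
    moreover have "{n. c n \<in> - D} = {}" using cT T(2) by blast
    ultimately show False by simp
  qed
  ultimately show ?thesis using that[of c] cT T(2) by blast
qed

section \<open>The constructed points: Hoelder estimate and expansion\<close>

text \<open>If the digits first differ at \<open>n\<close>, then \<open>y\<close> and
  \<open>z\<close> are within \<open>1 / M n\<close>, while their images are at least
  \<open>1 / (2 * P (Suc n))\<close> apart. The hypothesis \<open>growth\<close> compares these two
  scales, and \<open>2 powr s\<close> pays for the factor 2 in the separation.\<close>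

lemma cantor_image_holder:
  fixes b :: "nat \<Rightarrow> real" and a :: "nat \<Rightarrow> int" and m :: "nat \<Rightarrow> nat"
  defines "g \<equiv> \<lambda>y. \<Sum>i. (a i + digit m y i) / (\<Prod>j<Suc i. b j)"
  assumes b: "\<And>i. 2 \<le> b i" and m: "\<And>i. 1 \<le> m i" and a: "\<And>i. 0 \<le> a i"
    and am: "\<And>i. real_of_int (a i) + real (m i) \<le> b i"
    and half: "\<And>i. 2 * (real (m i) - 1) \<le> b i - 1"
    and growth: "\<And>n. (\<Prod>j<Suc n. b j) powr s \<le> B * real (\<Prod>i<n. m i)" and s: "0 < s"
    and yz: "y \<in> {0..<1}" "z \<in> {0..<1}"
  shows "\<bar>y - z\<bar> \<le> B * 2 powr s * \<bar>g y - g z\<bar> powr s"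
proof (cases "y = z")
  case False
  define P where "P n = (\<Prod>j<n. b j)" for n
  define M where "M n = real (\<Prod>i<n. m i)" for n
  have P: "0 < P n" for n unfolding P_def by (rule prod_pos_of_ge_2[of b, OF b])
  have M: "0 < M n" for n using m by (simp add: M_def prod_pos Suc_le_eq)
  have PM: "P (Suc n) powr s \<le> B * M n" for n unfolding P_def M_def by (rule growth)
  have close: "\<bar>y - z\<bar> \<le> B * (1 / P (Suc n)) powr s"
    if "\<And>i. i < n \<Longrightarrow> digit m y i = digit m z i" for n
  proof -
    have "\<bar>y - z\<bar> \<le> 1 / M n" unfolding M_def using digits_eq_imp_close[OF m yz that] .
    also have "\<dots> \<le> B / P (Suc n) powr s"
      using PM[of n] M[of n] P[of "Suc n"] by (simp add: field_simps)
    finally show ?thesis using P[of "Suc n"] by (simp add: powr_divide)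
  qed
  \<comment> \<open>If all digits agreed, \<open>close\<close> would hold for every \<open>n\<close>
    and force \<open>y = z\<close> in the limit.\<close>
  have "\<exists>n. digit m y n \<noteq> digit m z n"
  proof (rule ccontr)
    assume "\<nexists>n. digit m y n \<noteq> digit m z n"
    then have *: "\<bar>y - z\<bar> \<le> B * (1 / P (Suc n)) powr s" for n using close by blast
    have "(\<lambda>n. 1 / P n) \<longlonglongrightarrow> 0"
      using prod_at_top[of b, OF b] unfolding P_def divide_inverse mult_1
      by (rule tendsto_inverse_0_at_top)
    then have "(\<lambda>n. (1 / P n) powr s) \<longlonglongrightarrow> 0"
      by (rule tendsto_zero_powrI[OF _ tendsto_const _ s]) (simp add: less_imp_le[OF P])
    then have "(\<lambda>n. B * (1 / P (Suc n)) powr s) \<longlonglongrightarrow> B * 0"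
      by (intro tendsto_mult tendsto_const LIMSEQ_Suc)
    then have "\<bar>y - z\<bar> \<le> B * 0" using * by (intro LIMSEQ_le_const) auto
    then show False using False by simp
  qed
  then obtain n where n: "digit m y n \<noteq> digit m z n" "\<And>i. i < n \<Longrightarrow> digit m y i = digit m z i"
    using exists_least_iff[of "\<lambda>n. digit m y n \<noteq> digit m z n"] by blast
  have d: "0 \<le> digit m x i" "real_of_int (digit m x i) \<le> real (m i) - 1" for x i
    using digit_bounds[of m i x, OF m] by linarith+
  have "1 / (2 * P (Suc n)) \<le> \<bar>g y - g z\<bar>"
    unfolding P_def g_def
  proof (rule cantor_separation)
    fix i
    show "2 \<le> b i" by (rule b)
    show "0 \<le> a i + digit m y i" "0 \<le> a i + digit m z i" using a[of i] d by auto
    show "real_of_int (a i + digit m y i) \<le> b i - 1" "real_of_int (a i + digit m z i) \<le> b i - 1"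
      using am[of i] d[of y i] d[of z i] by simp_all
    \<comment> \<open>The offset \<open>a i\<close> cancels, and two positions in a block of
      \<open>m i\<close> integers differ by at most \<open>m i - 1\<close>.\<close>
    show "real_of_int \<bar>a i + digit m y i - (a i + digit m z i)\<bar> \<le> (b i - 1) / 2"
    proof -
      have "\<bar>digit m y i - digit m z i\<bar> < int (m i)"
        using digit_bounds[of m i y, OF m] digit_bounds[of m i z, OF m] by linarith
      then have "real_of_int \<bar>digit m y i - digit m z i\<bar> \<le> real (m i) - 1" by linarith
      then show ?thesis using half[of i] by simp
    qed
  qed (use n in auto)
  then have "(1 / (2 * P (Suc n))) powr s \<le> \<bar>g y - g z\<bar> powr s"
    using s P[of "Suc n"] by (intro powr_mono2) auto
  moreover have "0 \<le> B"
    using order_trans[OF powr_ge_zero PM[of 0]] by (simp add: M_def)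
  ultimately have "B * 2 powr s * (1 / (2 * P (Suc n))) powr s \<le> B * 2 powr s * \<bar>g y - g z\<bar> powr s"
    by (intro mult_left_mono) auto
  moreover have "2 powr s * (1 / (2 * P (Suc n))) powr s = (1 / P (Suc n)) powr s"
    using P[of "Suc n"] by (simp add: powr_divide powr_mult)
  ultimately show ?thesis using close[of n, OF n(2)] by (simp add: mult.assoc)
qed (use s in simp)

text \<open>All digits stay strictly below \<open>q (Suc i) - 1\<close>. This excludes a maximal
  tail and also makes the sum smaller than 1, so the entry 0 at index 0 is the correct integer
  part.\<close>

lemma cantor_expansion_series:
  fixes q :: "nat \<Rightarrow> int" and E :: "nat \<Rightarrow> int"
  defines "x \<equiv> \<Sum>i. E i / (\<Prod>j<Suc i. real_of_int (q (Suc j)))"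
  assumes q: "\<And>i. 2 \<le> q (Suc i)" and E: "\<And>i. 0 \<le> E i" "\<And>i. E i < q (Suc i) - 1"
  shows "cantor_expansion q x (\<lambda>n. case n of 0 \<Rightarrow> 0 | Suc i \<Rightarrow> E i)"
proof -
  define b where "b i = real_of_int (q (Suc i))" for i
  have b: "2 \<le> b i" for i using q[of i] by (simp add: b_def)
  have Eb: "real_of_int (E i) \<le> b i - 1" "real_of_int (E i) < b i - 1" for i
    using E(2)[of i] by (simp_all add: b_def)
  have x: "x = (\<Sum>i. E i / (\<Prod>j<Suc i. b j))" by (simp add: x_def b_def)
  have sum: "summable (\<lambda>i. E i / (\<Prod>j<Suc i. b j))"
    by (rule cantor_summable) (use b E Eb in auto)
  have "x < 1" unfolding x by (rule cantor_series_less_1[where k = 0]) (use b E Eb in auto)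
  moreover have "0 \<le> x"
    unfolding x using E(1) less_imp_le[OF prod_pos_of_ge_2[of b, OF b]]
    by (intro suminf_nonneg[OF sum] divide_nonneg_nonneg) (auto simp del: prod.lessThan_Suc)
  ultimately have "\<lfloor>x\<rfloor> = 0" by (simp add: floor_eq_iff)
  moreover have "real_of_int (\<Prod>i=1..Suc n. q i) = (\<Prod>j<Suc n. b j)" for n
    by (simp only: b_def of_int_prod prod.atLeast1_atMost_eq One_nat_def)
  moreover have "(case n of 0 \<Rightarrow> 0 | Suc i \<Rightarrow> E i) \<in> {0..q n - 1}"
    "(case n of 0 \<Rightarrow> 0 | Suc i \<Rightarrow> E i) \<noteq> q n - 1" if "n \<ge> 1" for n
    using that E(1)[of "n - 1"] E(2)[of "n - 1"] by (cases n; auto)+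
  moreover from this have "{n. n \<ge> 1 \<and> (case n of 0 \<Rightarrow> 0 | Suc i \<Rightarrow> E i) \<noteq> q n - 1} = {1..}" by auto
  ultimately show ?thesis
    unfolding cantor_expansion_def using sum x by (simp add: infinite_Ici)
qed

section \<open>Growth of the products and choice of the digit blocks\<close>

text \<open>From \<open>large\<close>, \<open>P n powr \<sigma>\<close> is at most a constant times
  \<open>M n\<close>. The gap between \<open>s\<close> and \<open>\<sigma>\<close> pays for the
  extra factor \<open>b n\<close> in \<open>P (Suc n)\<close>, which by \<open>ratio\<close> is
  below any fixed positive power of \<open>P n\<close>.\<close>

lemma prod_growth:
  fixes b :: "nat \<Rightarrow> real" and m :: "nat \<Rightarrow> nat"
  assumes b: "\<And>i. 2 \<le> b i" and m: "\<And>i. 1 \<le> m i"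
    and large: "\<And>i. N \<le> i \<Longrightarrow> b i powr \<sigma> \<le> real (m i)"
    and s: "0 < s" "s < \<sigma>"
    and ratio: "(\<lambda>n. ln (b n) / ln (\<Prod>i<n. b i)) \<longlonglongrightarrow> 0"
  obtains B where "0 < B" "\<And>n. (\<Prod>j<Suc n. b j) powr s \<le> B * real (\<Prod>i<n. m i)"
proof -
  define P where "P n = (\<Prod>j<n. b j)" for n
  define M where "M n = real (\<Prod>i<n. m i)" for n
  have P: "0 < P n" for n unfolding P_def by (rule prod_pos_of_ge_2[of b, OF b])
  have M: "1 \<le> M n" for n unfolding M_def of_nat_prod by (intro prod_ge_1) (use m in auto)
  have bpos: "0 < b i" for i using b[of i] by simp
  have PM: "P n powr \<sigma> \<le> P N powr \<sigma> * M n" if "N \<le> n" for n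
    using that
  proof (induction n rule: dec_induct)
    case base
    show ?case using mult_left_mono[OF M[of N], of "P N powr \<sigma>"] by simp
  next
    case (step n)
    have "P (Suc n) powr \<sigma> = P n powr \<sigma> * b n powr \<sigma>"
      using P[of n] bpos[of n] by (simp add: P_def powr_mult)
    also have "\<dots> \<le> (P N powr \<sigma> * M n) * real (m n)"
      using step large[of n] M[of n] by (intro mult_mono) auto
    finally show ?case by (simp add: M_def mult.assoc)
  qed
  \<comment> \<open>This threshold is chosen so that \<open>b n\<close> at most
    \<open>P n powr (\<sigma> / s - 1)\<close> is the same as \<open>P (Suc n) powr s\<close> at
    most \<open>P n powr \<sigma>\<close>.\<close>
  have "0 < \<sigma> / s - 1" using s by simp
  then have "\<forall>\<^sub>F n in sequentially. ln (b n) / ln (P n) < \<sigma> / s - 1"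
    using ratio unfolding P_def by (rule order_tendstoD(2)[rotated])
  then have "\<forall>\<^sub>F n in sequentially. norm (P (Suc n) powr s / M n) \<le> P N powr \<sigma>"
    using eventually_ge_at_top[of N] eventually_gt_at_top[of 0]
  proof eventually_elim
    case (elim n)
    \<comment> \<open>For \<open>n > 0\<close> the logarithm of \<open>P n\<close> is positive, so
      the quotient can be cleared; at \<open>n = 0\<close> it would be a division by zero.\<close>
    have "2 ^ 1 \<le> (2::real) ^ n" using elim by (intro power_increasing) auto
    then have "1 < P n" using power_le_prod[of b n, OF b] unfolding P_def by simp
    then have "ln (b n) \<le> (\<sigma> / s - 1) * ln (P n)" using elim(1) by (simp add: pos_divide_less_eq)
    moreover have "ln (P (Suc n)) = ln (P n) + ln (b n)"
      using ln_mult_pos[OF P[of n] bpos[of n]] by (simp add: P_def)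
    ultimately have "ln (P (Suc n)) \<le> \<sigma> / s * ln (P n)" by (simp add: algebra_simps)
    then have "s * ln (P (Suc n)) \<le> \<sigma> * ln (P n)" using s by (simp add: field_simps)
    then have "P (Suc n) powr s \<le> P n powr \<sigma>" using P[of n] P[of "Suc n"] by (simp add: powr_def)
    also have "\<dots> \<le> P N powr \<sigma> * M n" using PM elim by simp
    finally show ?case using M[of n] by (simp add: divide_le_eq)
  qed
  \<comment> \<open>Passing to a bounded sequence absorbs the finitely many early indices into
    \<open>B\<close>.\<close>
  then have "Bseq (\<lambda>n. P (Suc n) powr s / M n)" by (rule BfunI)
  then obtain B where B: "0 < B" "\<And>n. norm (P (Suc n) powr s / M n) \<le> B" by (rule BseqE) blast
  have "P (Suc n) powr s \<le> B * M n" for n using B(2)[of n] M[of n] by (simp add: divide_le_eq)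
  then show ?thesis using that B(1) unfolding P_def M_def by blast
qed

text \<open>Since \<open>c n\<close> stays below \<open>\<beta> < 1\<close>, a fixed proportion of
  the alphabet lies above the start of the block. Eventually this holds both the block, of length
  about \<open>q n powr \<sigma>\<close>, and the \<open>t n\<close> forbidden digits, as both are
  negligible against \<open>q n\<close>.\<close>

lemma digit_block_choice:
  fixes q :: "nat \<Rightarrow> int" and t :: "nat \<Rightarrow> nat" and c :: "nat \<Rightarrow> real"
  assumes q: "filterlim q at_top sequentially" and t: "(\<lambda>n. t n / q n) \<longlonglongrightarrow> 0"
    and qt: "\<And>n. 3 \<le> q n - int (t n)"
    and c: "\<And>n. 0 \<le> c n" "\<And>n. c n \<le> \<beta>" and \<beta>: "\<beta> < 1" and \<sigma>: "\<sigma> < 1"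
  obtains a :: "nat \<Rightarrow> int" and m :: "nat \<Rightarrow> nat" and N where
    "\<And>n. 0 \<le> a n" "\<And>n. 1 \<le> m n" "\<And>n. a n + int (m n) + int (t n) + 1 \<le> q n"
    "\<And>n. 2 * (real (m n) - 1) \<le> real_of_int (q n) - 1" "\<And>n. N \<le> n \<Longrightarrow> q n powr \<sigma> \<le> real (m n)"
    "(\<lambda>n. a n / q n - c n) \<longlonglongrightarrow> 0" "(\<lambda>n. m n / q n) \<longlonglongrightarrow> 0"
proof -
  define b where "b n = real_of_int (q n)" for n
  have b3: "3 \<le> b n" for n using qt[of n] by (simp add: b_def)
  have b: "filterlim b at_top sequentially"
    unfolding b_def by (rule filterlim_compose[OF filterlim_real_of_int_at_top q])
  have inv: "(\<lambda>n. 1 / b n) \<longlonglongrightarrow> 0"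
    unfolding divide_inverse mult_1 by (rule tendsto_inverse_0_at_top[OF b])
  have "(\<lambda>n. b n powr (\<sigma> - 1)) \<longlonglongrightarrow> 0" using \<sigma> by (intro tendsto_neg_powr b) auto
  then have pow: "(\<lambda>n. b n powr \<sigma> / b n) \<longlonglongrightarrow> 0"
  proof (rule Lim_transform_eventually)
    show "\<forall>\<^sub>F n in sequentially. b n powr (\<sigma> - 1) = b n powr \<sigma> / b n"
      using b3 by (intro always_eventually allI) (simp add: powr_diff order_trans[of 0 3])
  qed
  have "(\<lambda>n. \<beta> + b n powr \<sigma> / b n + t n / b n + 2 * (1 / b n)) \<longlonglongrightarrow> \<beta> + 0 + 0 + 2 * 0"
    using t unfolding b_def[symmetric] by (intro tendsto_intros pow inv)
  then have "\<forall>\<^sub>F n in sequentially. \<beta> + b n powr \<sigma> / b n + t n / b n + 2 * (1 / b n) < 1"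
    using \<beta> by (intro order_tendstoD(2)) auto
  moreover have "(\<lambda>n. 2 * (b n powr \<sigma> / b n) + 1 / b n) \<longlonglongrightarrow> 2 * 0 + 0"
    by (intro tendsto_intros pow inv)
  then have "\<forall>\<^sub>F n in sequentially. 2 * (b n powr \<sigma> / b n) + 1 / b n < 1"
    by (intro order_tendstoD(2)) auto
  \<comment> \<open>Of the summand 2, one unit covers the rounding up in \<open>m n\<close> and the
    other the spare digit in the conclusion. The second inequality keeps the block within half of
    the alphabet.\<close>
  ultimately have "\<forall>\<^sub>F n in sequentially.
      \<beta> * b n + b n powr \<sigma> + t n + 2 \<le> b n \<and> 2 * b n powr \<sigma> + 1 \<le> b n"
  proof eventually_elim
    case (elim n)
    then show ?case using b3[of n] by (simp add: field_simps)
  qed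
  then obtain N where N: "\<And>n. N \<le> n \<Longrightarrow> \<beta> * b n + b n powr \<sigma> + t n + 2 \<le> b n"
      "\<And>n. N \<le> n \<Longrightarrow> 2 * b n powr \<sigma> + 1 \<le> b n"
    unfolding eventually_sequentially by blast
  \<comment> \<open>Before \<open>N\<close> the block is just the digit 0, which \<open>qt\<close>
    permits.\<close>
  define a where "a n = (if n < N then 0 else \<lfloor>c n * b n\<rfloor>)" for n
  define m where "m n = (if n < N then 1 else nat \<lceil>b n powr \<sigma>\<rceil>)" for n
  have pos: "0 < b n powr \<sigma>" for n using b3[of n] by simp
  have m_real: "b n powr \<sigma> \<le> real (m n)" "real (m n) < b n powr \<sigma> + 1" if "N \<le> n" for n
  proof -
    have "real (m n) = real_of_int \<lceil>b n powr \<sigma>\<rceil>" using that pos[of n] by (simp add: m_def)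
    then show "b n powr \<sigma> \<le> real (m n)" "real (m n) < b n powr \<sigma> + 1" by linarith+
  qed
  have a_real: "c n * b n - 1 \<le> real_of_int (a n)" "real_of_int (a n) \<le> c n * b n" if "N \<le> n" for n
    using that by (simp_all add: a_def)
  show ?thesis
  proof (rule that)
    show "0 \<le> a n" for n using c(1)[of n] b3[of n] by (simp add: a_def)
    show "1 \<le> m n" for n using pos[of n] by (simp add: m_def Suc_le_eq)
    show "a n + int (m n) + int (t n) + 1 \<le> q n" for n
    proof (cases "n < N")
      case True
      then show ?thesis using qt[of n] by (simp add: a_def m_def)
    next
      case False
      have "c n * b n \<le> \<beta> * b n" using c(2)[of n] b3[of n] by (intro mult_right_mono) auto
      then have "real_of_int (a n) + real (m n) + t n + 1 \<le> b n"
        using False a_real[of n] m_real[of n] N(1)[of n] by simp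
      then show ?thesis unfolding b_def by linarith
    qed
    show "2 * (real (m n) - 1) \<le> real_of_int (q n) - 1" for n
      using m_real[of n] N(2)[of n] b3[of n] by (cases "n < N") (simp_all add: m_def b_def)
    show "q n powr \<sigma> \<le> real (m n)" if "N \<le> n" for n using m_real(1)[OF that] by (simp add: b_def)
    show "(\<lambda>n. a n / q n - c n) \<longlonglongrightarrow> 0"
    proof (rule Lim_null_comparison)
      show "\<forall>\<^sub>F n in sequentially. norm (a n / q n - c n) \<le> 1 / b n"
        using eventually_ge_at_top[of N]
      proof eventually_elim
        case (elim n)
        have "\<bar>a n - c n * b n\<bar> \<le> 1" using a_real[OF elim] by linarith
        moreover have "a n / q n - c n = (a n - c n * b n) / b n"
          using b3[of n] by (simp add: b_def diff_divide_distrib)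
        ultimately show ?case using b3[of n] by (simp add: divide_right_mono)
      qed
    qed (rule inv)
    show "(\<lambda>n. m n / q n) \<longlonglongrightarrow> 0"
    proof (rule Lim_null_comparison)
      show "\<forall>\<^sub>F n in sequentially. norm (m n / q n) \<le> b n powr \<sigma> / b n + 1 / b n"
        using eventually_ge_at_top[of N]
      proof eventually_elim
        case (elim n)
        then show ?case using m_real(2)[OF elim] b3[of n]
          by (simp add: b_def[symmetric] add_divide_distrib[symmetric] divide_right_mono)
      qed
      show "(\<lambda>n. b n powr \<sigma> / b n + 1 / b n) \<longlonglongrightarrow> 0" using tendsto_add[OF pow inv] by simp
    qed
  qed
qed

section \<open>Positive measure below dimension 1 and conclusion\<close>

lemma hausdorff_measure_EE_nonzero:
  fixes D :: "real set" and t :: "nat \<Rightarrow> nat" and q :: "nat \<Rightarrow> int"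
  assumes D: "D \<subseteq> {0<..<1}" "closed D" "D \<noteq> {}"
    and q: "filterlim q at_top sequentially"
    and ratio: "(\<lambda>n. ln (real_of_int (q (Suc n))) / ln (real_of_int (\<Prod>i=1..n. q i))) \<longlonglongrightarrow> 0"
    and t: "(\<lambda>n. t (Suc n) / q (Suc n)) \<longlonglongrightarrow> 0"
    and qt: "\<And>n. 3 \<le> q (Suc n) - int (t (Suc n))"
    and s: "0 < s" "s < 1"
  shows "hausdorff_measure s (EE D t q) \<noteq> 0"
proof -
  define b where "b n = real_of_int (q (Suc n))" for n
  \<comment> \<open>Any value strictly between \<open>s\<close> and 1 serves: above \<open>s\<close>
    for the product growth, below 1 for blocks of negligible relative length.\<close>
  define \<sigma> where "\<sigma> = (1 + s) / 2"
  have \<sigma>: "s < \<sigma>" "\<sigma> < 1" using s by (simp_all add: \<sigma>_def)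
  have q3: "3 \<le> q (Suc n)" for n using qt[of n] by simp
  have b: "2 \<le> b n" for n using q3[of n] by (simp add: b_def)
  obtain c where c: "range c \<subseteq> D" "accumulation_points c = D"
    using accumulation_points_exists[OF D(2,3)] by blast
  \<comment> \<open>A compact subset of the open interval attains its maximum
    \<open>\<beta>\<close>, which is therefore strictly below 1. This bounds \<open>c\<close> away
    from 1 uniformly.\<close>
  have "bounded D" by (rule bounded_subset[OF _ D(1)]) simp
  then have "compact D" using D(2) by (simp add: compact_eq_bounded_closed)
  then obtain \<beta> where \<beta>: "\<beta> \<in> D" "\<And>x. x \<in> D \<Longrightarrow> x \<le> \<beta>"
    using compact_attains_sup[OF _ D(3)] by blast
  have cD: "c n \<in> D" for n using c(1) by blast
  have c01: "0 \<le> c n" "c n \<le> \<beta>" for n using D(1) cD[of n] \<beta>(2) by auto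
  have \<beta>1: "\<beta> < 1" using D(1) \<beta>(1) by auto
  have qS: "filterlim (\<lambda>n. q (Suc n)) at_top sequentially"
    by (rule filterlim_compose[OF q filterlim_Suc])
  obtain a m N where a: "\<And>n. 0 \<le> a n" and m: "\<And>n. 1 \<le> m n"
    and fit: "\<And>n. a n + int (m n) + int (t (Suc n)) + 1 \<le> q (Suc n)"
    and half: "\<And>n. 2 * (real (m n) - 1) \<le> real_of_int (q (Suc n)) - 1"
    and large: "\<And>n. N \<le> n \<Longrightarrow> q (Suc n) powr \<sigma> \<le> real (m n)"
    and lim: "(\<lambda>n. a n / q (Suc n) - c n) \<longlonglongrightarrow> 0" "(\<lambda>n. m n / q (Suc n)) \<longlonglongrightarrow> 0"
    by (rule digit_block_choice[where c = c, OF qS t qt c01 \<beta>1 \<sigma>(2)]) (rule that)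
  have ratio': "(\<lambda>n. ln (b n) / ln (\<Prod>i<n. b i)) \<longlonglongrightarrow> 0"
    using ratio by (simp only: b_def of_int_prod prod.atLeast1_atMost_eq One_nat_def)
  obtain B where B: "0 < B" "\<And>n. (\<Prod>j<Suc n. b j) powr s \<le> B * real (\<Prod>i<n. m i)"
    by (rule prod_growth[of b m N \<sigma> s, OF b m large[folded b_def] s(1) \<sigma>(1) ratio'])
      (assumption, rule that)
  define E where "E y i = a i + digit m y i" for y i
  define g where "g y = (\<Sum>i. E y i / (\<Prod>j<Suc i. b j))" for y
  have d: "0 \<le> digit m y i" "digit m y i < int (m i)" for y i
    using digit_bounds[of m i y, OF m] by auto
  have "g y \<in> EE D t q" for y
  proof -
    define F where "F n = (case n of 0 \<Rightarrow> 0 | Suc i \<Rightarrow> E y i)" for n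
    have "cantor_expansion q (g y) F"
      unfolding g_def b_def F_def
    proof (rule cantor_expansion_series)
      fix i
      show "2 \<le> q (Suc i)" using q3[of i] by simp
      show "0 \<le> E y i" using a[of i] d[of y i] by (simp add: E_def)
      \<comment> \<open>The spare digit in \<open>fit\<close> matters here: it keeps the digit off
        the maximal value even where \<open>t\<close> vanishes.\<close>
      show "E y i < q (Suc i) - 1" using fit[of i] d[of y i] by (simp add: E_def)
    qed
    moreover have "F n < q n - int (t n)" if "n \<ge> 1" for n
      using that fit[of "n - 1"] d[of y "n - 1"] by (cases n) (auto simp: F_def E_def)
    moreover have "accumulation_points (\<lambda>n. F (Suc n) / q (Suc n)) = D"
    proof -
      \<comment> \<open>The position in the block is negligible against the base, so the digit
        ratios follow \<open>c\<close> whatever \<open>y\<close> is.\<close>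
      have "(\<lambda>n. digit m y n / q (Suc n)) \<longlonglongrightarrow> 0"
      proof (rule Lim_null_comparison[OF always_eventually lim(2)], rule allI)
        fix n
        have "real_of_int (digit m y n) \<le> real (m n)" using d(2)[of y n] by linarith
        then show "norm (digit m y n / q (Suc n)) \<le> m n / q (Suc n)"
          using d(1)[of y n] q3[of n] by (simp add: divide_right_mono)
      qed
      then have "(\<lambda>n. (a n / q (Suc n) - c n) + digit m y n / q (Suc n)) \<longlonglongrightarrow> 0 + 0"
        by (intro tendsto_add lim(1))
      moreover have "F (Suc n) / q (Suc n) - c n
          = (a n / q (Suc n) - c n) + digit m y n / q (Suc n)" for n
        by (simp add: F_def E_def add_divide_distrib)
      ultimately have "(\<lambda>n. F (Suc n) / q (Suc n) - c n) \<longlonglongrightarrow> 0" by (simp only: add_0)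
      from accumulation_points_cong[OF this] show ?thesis by (simp only: c(2))
    qed
    ultimately show ?thesis unfolding EE_def by (auto simp: F_def)
  qed
  then have image: "g ` {0..<1} \<subseteq> EE D t q" by blast
  show ?thesis
  proof (rule hausdorff_measure_nonzero[OF s(1) _ image])
    show "0 < B * 2 powr s" using B by simp
    fix y z :: real assume yz: "y \<in> {0..<1}" "z \<in> {0..<1}"
    have "real_of_int (a i) + real (m i) \<le> b i" for i
    proof -
      have "a i + int (m i) \<le> q (Suc i)" using fit[of i] by simp
      then show ?thesis unfolding b_def by linarith
    qed
    then show "\<bar>y - z\<bar> \<le> B * 2 powr s * dist (g y) (g z) powr s"
      unfolding g_def E_def dist_real_def
      by (intro cantor_image_holder b m a half[folded b_def] B(2) s(1) yz)
  qed
qed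

theorem theorem4p5:
  fixes D :: "real set" and t :: "nat \<Rightarrow> nat" and q :: "nat \<Rightarrow> int"
  assumes "D \<subseteq> {0<..<1}" and "closed D" and "D \<noteq> {}"
    and "basic_sequence q" and "infinite_in_limit q"
    and "\<And>j. j \<ge> 1 \<Longrightarrow>
      (\<lambda>n. ln (real_of_int (q (n + j))) / ln (real_of_int (\<Prod>i=1..n. q i))) \<longlonglongrightarrow> 0"
    and "summable (\<lambda>n. real (t (Suc n)) / real_of_int (q (Suc n)))"
    and "\<And>n. n \<ge> 1 \<Longrightarrow> q n - int (t n) \<ge> 3"
  shows "hausdorff_dim (EE D t q) = 1"
proof (rule hausdorff_dim_eq_1I)
  show "EE D t q \<subseteq> {0..<1}"
    unfolding EE_def cantor_expansion_def by (auto simp: floor_eq_iff)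
  show nonzero: "hausdorff_measure s (EE D t q) \<noteq> 0" if "0 < s" "s < 1" for s
    using assms(1-3,5,8) assms(6)[of 1] summable_LIMSEQ_zero[OF assms(7)] that
    by (intro hausdorff_measure_EE_nonzero) (auto simp: infinite_in_limit_def)
  \<comment> \<open>Nonemptiness comes from the positive measure at one exponent, here 1/2, because
    the empty set, covered by empty sets, has measure 0.\<close>
  have "hausdorff_pre_measure (1/2) \<delta> ({} :: real set) = 0" if "0 < \<delta>" for \<delta>
    unfolding hausdorff_pre_measure_def le_zero_eq[symmetric]
    by (rule INF_lower2[of "\<lambda>_. {}"]) (use that in \<open>auto simp: diam_power_def\<close>)
  then have "hausdorff_measure (1/2) ({} :: real set) = 0"
    unfolding hausdorff_measure_def by (simp add: SUP_eq_iff bot_ennreal)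
  then show "EE D t q \<noteq> {}" using nonzero[of "1/2"] by auto
qed

end
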